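(* Let $x,y\in\mathbb{R}^d$ be drawn independently at random with respect to the spherical Gaussian distribution with zero mean and unit variance. Then for every $\epsilon>0$ and all $d\geq 1$, $$\mathrm{P}\Bigl[\,\Bigl|\Bigl\langle \frac{x}{\|x\|},\frac{y}{\|y\|}\Bigr\rangle\Bigr|\geq \epsilon\,\Bigr]\leq \frac{2/\epsilon+7}{\sqrt{d}}.$$
   Context: The spherical Gaussian distribution on $\mathbb{R}^d$ with zero mean and unit variance has density $(2\pi)^{-d/2}\exp(-\|x\|^2/2)$ with respect to Lebesgue measure. $\langle\cdot,\cdot\rangle$ and $\|\cdot\|$ are the Euclidean scalar product and norm. The event $x=0$ or $y=0$ has probability zero and is tacitly disregarded (one may condition on $x\neq 0$ and $y\neq 0$). *)

theory Defs
  imports "HOL-Probability.Probability"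
begin

definition std_gaussian_density :: "real ^ 'n \<Rightarrow> real" where
  "std_gaussian_density x =
     (2 * pi) powr (- (real CARD('n) / 2)) * exp (- ((norm x)\<^sup>2 / 2))"

end

theory Submission
  imports Defs
begin

text \<open>
  Write $d$ for the dimension and \<open>sgn x\<close> for the normalised vector $x / \|x\|$ (zero if $x = 0$).
  The Gaussian density depends on the norm only, so the law of $Y$ is unchanged when coordinates
  are permuted or change sign. Sign changes make the coordinates of \<open>sgn Y\<close> uncorrelated,
  permutations give them a common second moment, and these $d$ moments sum to at most $1$.
  Hence the second-moment matrix of \<open>sgn Y\<close> is at most $1/d$ times the identity, and
  $E \langle u, \mathrm{sgn}\, Y\rangle^2 \le \|u\|^2/d$ for every fixed $u$
  (\<open>second_moment_direction_le\<close>). By independence and Fubini, $u$ may be replaced by the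
  random vector \<open>sgn X\<close>, so the cosine between $X$ and $Y$ has second moment at most $1/d$
  (\<open>second_moment_cosine_le\<close>).

  Chebyshev's inequality now bounds the probability $P$ in question by $1/(\epsilon^2 d)$.
  Since $P \le 1$ gives $P^2 \le P$, it follows that $P \le 1/(\epsilon \sqrt d)$
  (\<open>prob_cosine_ge_le\<close>), which is stronger than the bound claimed.
\<close>

text \<open>
  For $s$ with values in $\{-1, 1\}$ and bijective $p$ these are the signed permutation matrices,
  that is, the symmetries of the cube: a group of orthogonal maps that is large enough to
  determine second moments up to a scalar, yet maps boxes to boxes, which makes the invariance of
  Lebesgue measure elementary.
\<close>
definition signed_perm :: "('n \<Rightarrow> real) \<Rightarrow> ('n \<Rightarrow> 'n) \<Rightarrow> real ^ 'n \<Rightarrow> real ^ 'n" where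
  "signed_perm s p x = (\<chi> i. s i * x $ p i)"

lemma signed_perm_nth [simp]: "signed_perm s p x $ i = s i * x $ p i"
  by (simp add: signed_perm_def)

lemma borel_measurable_signed_perm [measurable]: "signed_perm s p \<in> borel_measurable borel"
  unfolding signed_perm_def
  by (intro borel_measurable_continuous_onI continuous_intros)

lemma norm_signed_perm:
  fixes p :: "'n::finite \<Rightarrow> 'n"
  assumes "bij p" and "\<And>i. \<bar>s i\<bar> = 1"
  shows "norm (signed_perm s p x) = norm x"
proof -
  have "(\<Sum>i\<in>UNIV. (norm (x $ p i))\<^sup>2) = (\<Sum>i\<in>UNIV. (norm (x $ i))\<^sup>2)"
    by (rule sum.reindex_bij_betw[OF assms(1)])
  then show ?thesis
    by (simp add: norm_vec_def L2_set_def abs_mult assms(2))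
qed

lemma sgn_signed_perm:
  fixes p :: "'n::finite \<Rightarrow> 'n"
  assumes "bij p" and "\<And>i. \<bar>s i\<bar> = 1"
  shows "sgn (signed_perm s p x) = signed_perm s p (sgn x)"
  using norm_signed_perm[OF assms, where x = x] by (simp add: sgn_div_norm vec_eq_iff)

text \<open>
  Lebesgue measure is determined by its values on boxes. The preimage of a box is again a box,
  whose side lengths are those of the original one in a different order.
\<close>
lemma lborel_distr_signed_perm:
  fixes p :: "'n::finite \<Rightarrow> 'n"
  assumes p: "bij p" and s: "\<And>i. \<bar>s i\<bar> = 1"
  shows "distr lborel borel (signed_perm s p) = lborel"
proof (rule lborel_eqI[symmetric])
  fix l u :: "real ^ 'n"
  assume "\<And>b. b \<in> Basis \<Longrightarrow> l \<bullet> b \<le> u \<bullet> b"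
  then have lu: "l $ i \<le> u $ i" for i
    by (simp add: cart_eq_inner_axis axis_in_Basis_iff)
  define q where "q = inv p"
  have q: "bij q" and qp: "q (p i) = i" and pq: "p (q i) = i" for i
    using p by (auto simp: q_def bij_imp_bij_inv bij_is_inj bij_is_surj surj_f_inv_f)
  \<comment> \<open>Side \<open>j\<close> of the preimage comes from side \<open>q j\<close>; a negative sign swaps and negates its ends.\<close>
  define l' where "l' = (\<chi> j. if s (q j) = 1 then l $ q j else - u $ q j)"
  define u' where "u' = (\<chi> j. if s (q j) = 1 then u $ q j else - l $ q j)"
  have s': "s i = 1 \<or> s i = -1" for i
    using s[of i] by (auto simp: abs_if split: if_splits)
  have coord: "(l $ i < s i * x $ p i \<and> s i * x $ p i < u $ i) \<longleftrightarrow>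
               (l' $ p i < x $ p i \<and> x $ p i < u' $ p i)" for i x
    using s'[of i] by (auto simp: l'_def u'_def qp)
  have "signed_perm s p -` box l u = box l' u'"
    unfolding set_eq_iff vimage_eq mem_box_cart signed_perm_nth coord
    by (metis pq)
  moreover have "l' $ j \<le> u' $ j" for j
    using lu by (simp add: l'_def u'_def)
  then have "\<And>b. b \<in> Basis \<Longrightarrow> l' \<bullet> b \<le> u' \<bullet> b"
    by (auto simp: Basis_vec_def inner_axis)
  ultimately have "emeasure (distr lborel borel (signed_perm s p)) (box l u) =
      (\<Prod>b\<in>Basis. (u' - l') \<bullet> b)"
    by (simp add: emeasure_distr)
  also have "(\<Prod>b\<in>Basis. (u' - l') \<bullet> b) = (\<Prod>j\<in>UNIV. (u' - l') $ j)"
    by (subst prod.reindex_bij_betw[symmetric, of "\<lambda>j. axis j 1" UNIV])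
       (auto simp: bij_betw_def inj_on_def axis_eq_axis Basis_vec_def inner_axis)
  also have "\<dots> = (\<Prod>j\<in>UNIV. (u - l) $ q j)"
    by (intro prod.cong) (auto simp: u'_def l'_def)
  also have "\<dots> = (\<Prod>i\<in>UNIV. (u - l) $ i)"
    by (rule prod.reindex_bij_betw[OF q])
  also have "\<dots> = (\<Prod>b\<in>Basis. (u - l) \<bullet> b)"
    by (subst prod.reindex_bij_betw[symmetric, of "\<lambda>j. axis j 1" UNIV])
       (auto simp: bij_betw_def inj_on_def axis_eq_axis Basis_vec_def inner_axis)
  finally show "emeasure (distr lborel borel (signed_perm s p)) (box l u) =
      (\<Prod>b\<in>Basis. (u - l) \<bullet> b)" .
qed simp

lemma distr_density_lborel_signed_perm:
  fixes p :: "'n::finite \<Rightarrow> 'n" and f :: "real ^ 'n \<Rightarrow> ennreal"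
  assumes [measurable]: "f \<in> borel_measurable borel"
    and radial: "\<And>x y. norm x = norm y \<Longrightarrow> f x = f y"
    and p: "bij p" and s: "\<And>i. \<bar>s i\<bar> = 1"
  shows "distr (density lborel f) borel (signed_perm s p) = density lborel f"
proof -
  have "distr (density lborel f) borel (signed_perm s p) =
      distr (density lborel (\<lambda>x. f (signed_perm s p x))) borel (signed_perm s p)"
    using radial[OF norm_signed_perm[OF p s]] by simp
  also have "\<dots> = density (distr lborel borel (signed_perm s p)) f"
    by (rule density_distr[symmetric]) auto
  finally show ?thesis
    by (simp add: lborel_distr_signed_perm[OF p s])
qed

lemma abs_sgn_nth_le_1: "\<bar>sgn (x :: real ^ 'n) $ i\<bar> \<le> 1"
  using component_le_norm_cart[of "sgn x" i] by (auto simp: norm_sgn split: if_splits)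

lemma borel_measurable_vec_nth [measurable]:
  "(\<lambda>x :: real ^ 'n. x $ i) \<in> borel_measurable borel"
  by (intro borel_measurable_continuous_onI continuous_intros)

text \<open>
  A symmetric matrix that commutes with all signed permutations is a scalar multiple of the
  identity. Applied to the matrix $E$ of second moments of \<open>sgn y\<close>, this leaves one
  unknown scalar, and the trace of $E$, which is the second moment of $\|\mathrm{sgn}\, y\|$,
  bounds it by $1/d$.
\<close>
lemma second_moment_direction_le:
  fixes N :: "(real ^ 'n) measure"
  assumes "prob_space N" and sets [measurable_cong]: "sets N = sets borel"
    and inv: "\<And>s p. bij p \<Longrightarrow> (\<And>i. \<bar>s i\<bar> = 1) \<Longrightarrow> distr N borel (signed_perm s p) = N"
  shows "(\<integral>y. (u \<bullet> sgn y)\<^sup>2 \<partial>N) \<le> (norm u)\<^sup>2 / real CARD('n)"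
proof -
  interpret prob_space N by fact
  define E where "E i j = (\<integral>y. sgn y $ i * sgn y $ j \<partial>N)" for i j
  have int: "integrable N (\<lambda>y. sgn y $ i * sgn y $ j)" for i j
    by (rule integrable_const_bound[where B = 1])
       (auto simp: abs_mult intro!: mult_le_one abs_sgn_nth_le_1)
  have E_inv: "E i j = s i * s j * E (p i) (p j)" if "bij p" "\<And>i. \<bar>s i\<bar> = 1" for s p i j
  proof -
    have "E i j = (\<integral>y. sgn y $ i * sgn y $ j \<partial>distr N borel (signed_perm s p))"
      by (simp add: E_def inv that)
    also have "\<dots> = (\<integral>y. (s i * s j) * (sgn y $ p i * sgn y $ p j) \<partial>N)"
      by (subst integral_distr) (auto simp: sgn_signed_perm that mult_ac)
    finally show ?thesis
      by (simp add: E_def)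
  qed
  \<comment> \<open>Flipping the sign of coordinate \<open>i\<close> alone turns \<open>E i j\<close> into its negative.\<close>
  have off_diagonal: "E i j = 0" if "i \<noteq> j" for i j
    using E_inv[of id "\<lambda>k. if k = i then -1 else 1" i j] that by (simp split: if_splits)
  have diagonal: "E i i = E j j" for i j
    using E_inv[of "Transposition.transpose i j" "\<lambda>_. 1" i i] by simp
  have "(\<Sum>j\<in>UNIV. E j j) = (\<integral>y. (\<Sum>j\<in>UNIV. sgn y $ j * sgn y $ j) \<partial>N)"
    unfolding E_def by (rule Bochner_Integration.integral_sum[symmetric]) (rule int)
  also have "\<dots> \<le> (\<integral>y. 1 \<partial>N)"
  proof (rule integral_mono)
    fix y :: "real ^ 'n"
    have "(\<Sum>j\<in>UNIV. sgn y $ j * sgn y $ j) = (norm (sgn y))\<^sup>2"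
      by (simp add: power2_norm_eq_inner inner_vec_def)
    then show "(\<Sum>j\<in>UNIV. sgn y $ j * sgn y $ j) \<le> 1"
      by (simp add: norm_sgn)
  qed (use int in auto)
  finally have trace: "(\<Sum>j\<in>UNIV. E j j) \<le> 1"
    by (simp add: prob_space)
  have E_le: "E i i \<le> 1 / real CARD('n)" for i
  proof -
    have "(\<Sum>j\<in>UNIV. E j j) = real CARD('n) * E i i"
      by (subst sum.cong[OF refl diagonal[of _ i]]) simp
    with trace show ?thesis
      by (simp add: field_simps)
  qed
  have "(\<integral>y. (u \<bullet> sgn y)\<^sup>2 \<partial>N) =
      (\<integral>y. (\<Sum>i\<in>UNIV. \<Sum>j\<in>UNIV. (u $ i * u $ j) * (sgn y $ i * sgn y $ j)) \<partial>N)"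
    by (simp add: power2_eq_square inner_vec_def sum_product mult_ac)
  also have "\<dots> = (\<Sum>i\<in>UNIV. \<Sum>j\<in>UNIV. (u $ i * u $ j) * E i j)"
    using int by (simp add: E_def)
  also have "\<dots> = (\<Sum>i\<in>UNIV. (u $ i)\<^sup>2 * E i i)"
  proof (rule sum.cong)
    fix i
    have "(\<Sum>j\<in>UNIV. (u $ i * u $ j) * E i j) = (\<Sum>j\<in>{i}. (u $ i * u $ j) * E i j)"
      by (rule sum.mono_neutral_right) (auto simp: off_diagonal)
    then show "(\<Sum>j\<in>UNIV. (u $ i * u $ j) * E i j) = (u $ i)\<^sup>2 * E i i"
      by (simp add: power2_eq_square)
  qed simp
  also have "\<dots> \<le> (\<Sum>i\<in>UNIV. (u $ i)\<^sup>2 * (1 / real CARD('n)))"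
    by (intro sum_mono mult_left_mono E_le) auto
  also have "\<dots> = (norm u)\<^sup>2 / real CARD('n)"
    by (simp only: power2_norm_eq_inner inner_vec_def)
       (simp add: power2_eq_square sum_divide_distrib)
  finally show ?thesis .
qed

lemma abs_inner_sgn_le_1: "\<bar>sgn x \<bullet> sgn y\<bar> \<le> (1 :: real)"
  using Cauchy_Schwarz_ineq2[of "sgn x" "sgn y"] by (auto simp: norm_sgn split: if_splits)

text \<open>
  The joint law of $X$ and $Y$ is a product, so the expectation can be taken over $Y$ first, with
  \<open>sgn X\<close> held fixed as a direction of norm at most $1$.
\<close>
lemma (in prob_space) second_moment_cosine_le:
  fixes X Y :: "'a \<Rightarrow> real ^ 'n"
  assumes indep: "indep_var borel X borel Y"
    and inv: "\<And>s p. bij p \<Longrightarrow> (\<And>i. \<bar>s i\<bar> = 1) \<Longrightarrow>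
      distr (distr M borel Y) borel (signed_perm s p) = distr M borel Y"
  shows "expectation (\<lambda>\<omega>. (sgn (X \<omega>) \<bullet> sgn (Y \<omega>))\<^sup>2) \<le> 1 / real CARD('n)"
proof -
  from indep have X [measurable]: "random_variable borel X"
    and Y [measurable]: "random_variable borel Y"
    and joint: "distr M borel X \<Otimes>\<^sub>M distr M borel Y =
      distr M (borel \<Otimes>\<^sub>M borel) (\<lambda>\<omega>. (X \<omega>, Y \<omega>))"
    by (simp_all add: indep_var_distribution_eq)
  interpret X: prob_space "distr M borel X"
    by (rule prob_space_distr) (rule X)
  interpret Y: prob_space "distr M borel Y"
    by (rule prob_space_distr) (rule Y)
  interpret XY: pair_prob_space "distr M borel X" "distr M borel Y" ..
  let ?g = "\<lambda>(x :: real ^ 'n, y :: real ^ 'n). (sgn x \<bullet> sgn y)\<^sup>2"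
  have [measurable]: "?g \<in> borel_measurable (borel \<Otimes>\<^sub>M borel)"
    by measurable
  have bound: "(sgn x \<bullet> sgn y)\<^sup>2 \<le> 1" for x y :: "real ^ 'n"
    using abs_inner_sgn_le_1[of x y] by (simp add: abs_square_le_1)
  have int: "integrable (distr M borel X \<Otimes>\<^sub>M distr M borel Y) ?g"
    by (rule XY.integrable_const_bound[where B = 1]) (auto simp: bound)
  have "expectation (\<lambda>\<omega>. (sgn (X \<omega>) \<bullet> sgn (Y \<omega>))\<^sup>2) =
      (\<integral>z. ?g z \<partial>(distr M borel X \<Otimes>\<^sub>M distr M borel Y))"
    unfolding joint by (subst integral_distr) auto
  also have "\<dots> = (\<integral>x. (\<integral>y. (sgn x \<bullet> sgn y)\<^sup>2 \<partial>distr M borel Y) \<partial>distr M borel X)"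
    using XY.integral_fst'[OF int] by simp
  also have "\<dots> \<le> (\<integral>x. 1 / real CARD('n) \<partial>distr M borel X)"
  proof (rule integral_mono)
    show "integrable (distr M borel X) (\<lambda>x. \<integral>y. (sgn x \<bullet> sgn y)\<^sup>2 \<partial>distr M borel Y)"
      using XY.integrable_fst'[OF int] by simp
    fix x :: "real ^ 'n"
    have "(\<integral>y. (sgn x \<bullet> sgn y)\<^sup>2 \<partial>distr M borel Y) \<le> (norm (sgn x))\<^sup>2 / real CARD('n)"
      by (rule second_moment_direction_le) (use inv Y.prob_space_axioms in auto)
    also have "\<dots> \<le> 1 / real CARD('n)"
      by (intro divide_right_mono) (auto simp: norm_sgn)
    finally show "(\<integral>y. (sgn x \<bullet> sgn y)\<^sup>2 \<partial>distr M borel Y) \<le> 1 / real CARD('n)" .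
  qed simp
  finally show ?thesis
    by (simp add: X.prob_space del: space_distr)
qed

text \<open>
  Chebyshev's inequality alone gives decay of order $1/(\epsilon^2 d)$; passing from $P$ to
  $P^2 \le P$ trades this for a bound that is linear in $1/\epsilon$.
\<close>
lemma (in prob_space) prob_cosine_ge_le:
  fixes X Y :: "'a \<Rightarrow> real ^ 'n"
  assumes indep: "indep_var borel X borel Y"
    and inv: "\<And>s p. bij p \<Longrightarrow> (\<And>i. \<bar>s i\<bar> = 1) \<Longrightarrow>
      distr (distr M borel Y) borel (signed_perm s p) = distr M borel Y"
    and "\<epsilon> > 0"
  shows "prob {\<omega> \<in> space M. \<bar>sgn (X \<omega>) \<bullet> sgn (Y \<omega>)\<bar> \<ge> \<epsilon>} \<le> 1 / (\<epsilon> * sqrt (real CARD('n)))"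
proof -
  from indep have [measurable]: "random_variable borel X" "random_variable borel Y"
    by (simp_all add: indep_var_distribution_eq)
  let ?P = "prob {\<omega> \<in> space M. \<bar>sgn (X \<omega>) \<bullet> sgn (Y \<omega>)\<bar> \<ge> \<epsilon>}"
  have "?P\<^sup>2 \<le> ?P"
    by (simp add: power2_eq_square mult_left_le)
  also have "?P \<le> expectation (\<lambda>\<omega>. (sgn (X \<omega>) \<bullet> sgn (Y \<omega>))\<^sup>2) / \<epsilon>\<^sup>2"
  proof (rule second_moment_method)
    show "integrable M (\<lambda>\<omega>. (sgn (X \<omega>) \<bullet> sgn (Y \<omega>))\<^sup>2)"
      by (rule integrable_const_bound[where B = 1])
         (auto simp: abs_square_le_1 abs_inner_sgn_le_1)
  qed (use \<open>\<epsilon> > 0\<close> in auto)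
  also have "\<dots> \<le> (1 / real CARD('n)) / \<epsilon>\<^sup>2"
    by (intro divide_right_mono second_moment_cosine_le indep inv) auto
  also have "\<dots> = (1 / (\<epsilon> * sqrt (real CARD('n))))\<^sup>2"
    by (simp add: power_divide power_mult_distrib)
  finally show ?thesis
    by (rule power2_le_imp_le) (use \<open>\<epsilon> > 0\<close> in auto)
qed

theorem theorem4p9:
  fixes M :: "'a measure"
    and X Y :: "'a \<Rightarrow> real ^ 'n"
    and \<epsilon> :: real
  assumes "prob_space M"
    and "distributed M lborel X std_gaussian_density"
    and "distributed M lborel Y std_gaussian_density"
    and "prob_space.indep_var M borel X borel Y"
    and "\<epsilon> > 0"
  shows "measure M {\<omega> \<in> space M.
           \<bar>(X \<omega> /\<^sub>R norm (X \<omega>)) \<bullet> (Y \<omega> /\<^sub>R norm (Y \<omega>))\<bar> \<ge> \<epsilon>}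
         \<le> (2 / \<epsilon> + 7) / sqrt (real CARD('n))"
proof -
  interpret prob_space M by fact
  let ?f = "\<lambda>x :: real ^ 'n. ennreal (std_gaussian_density x)"
  have f: "?f \<in> borel_measurable borel" and "distr M lborel Y = density lborel ?f"
    using assms(3) by (auto simp: distributed_def)
  then have Y: "distr M borel Y = density lborel ?f"
    by (simp cong: distr_cong)
  have inv: "distr (distr M borel Y) borel (signed_perm s p) = distr M borel Y"
    if "bij p" "\<And>i. \<bar>s i\<bar> = 1" for s p
    unfolding Y using f that
    by (intro distr_density_lborel_signed_perm) (auto simp: std_gaussian_density_def)
  have "prob {\<omega> \<in> space M. \<bar>sgn (X \<omega>) \<bullet> sgn (Y \<omega>)\<bar> \<ge> \<epsilon>} \<le> 1 / (\<epsilon> * sqrt (real CARD('n)))"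
    using assms(4) inv \<open>\<epsilon> > 0\<close> by (rule prob_cosine_ge_le)
  also have "\<dots> = (1 / \<epsilon>) / sqrt (real CARD('n))"
    by simp
  also have "\<dots> \<le> (2 / \<epsilon> + 7) / sqrt (real CARD('n))"
    using \<open>\<epsilon> > 0\<close> by (intro divide_right_mono) (auto simp: field_simps)
  finally show ?thesis
    by (simp only: sgn_div_norm)
qed

end
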